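(* Let $n \geq 1$ and $0 \leq m \leq n$ be integers, and let $\mathbf{t} = (t_1, t_2, \ldots, t_m) \in [n]^m$ be an increasing list (i.e. $t_1 < t_2 < \cdots < t_m$). Let $\mathbf{u} = (u_1, u_2, \ldots, u_{n-m})$ be the increasing rearrangement of $[n] \setminus \{t_1, \ldots, t_m\}$, and let $\mathbf{x} = (u_1, u_2 - u_1, u_3 - u_2, \ldots, u_{n-m} - u_{n-m-1})$. Then the set of parking completions of length $n$ for $\mathbf{t}$ is exactly the set of $\mathbf{x}$-parking functions of length $n-m$; that is, $\operatorname{PC}_n(\mathbf{t}) = \operatorname{PF}_{n-m}(\mathbf{x})$.
   Context: Write $[n] = \{1, 2, \ldots, n\}$ and $\mathbb{N} = \{1, 2, 3, \ldots\}$. Parking functions: on a one-way street there are $n$ spots numbered $1, \ldots, n$ in order. Given a preference list $\mathbf{a} = (a_1, \ldots, a_n) \in [n]^n$, cars $1, 2, \ldots, n$ enter in this order; car $i$ parks in the first available spot numbered at least $a_i$, if one exists. The list $\mathbf{a}$ is a parking function of length $n$ if all cars can park. Equivalently (a standard fact), the weakly increasing rearrangement $\mathbf{a}^\uparrow$ of $\mathbf{a}$ satisfies $a_i^\uparrow \leq i$ for all $i \in [n]$. Parking completions: for a fixed increasing list $\mathbf{t} = (t_1, \ldots, t_m) \in [n]^m$ (spots already taken, so the $t_j$ are distinct), a sequence $\mathbf{c} = (c_1, \ldots, c_{n-m}) \in [n]^{n-m}$ is a parking completion for $\mathbf{t}$ if the concatenation $(t_1, \ldots, t_m, c_1, \ldots,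 c_{n-m})$ is a parking function of length $n$. The set of all parking completions for $\mathbf{t}$ (called "of length $n$" because the street has $n$ spots) is denoted $\operatorname{PC}_n(\mathbf{t})$. $\mathbf{x}$-parking functions: for $\mathbf{x} = (x_1, \ldots, x_N) \in \mathbb{N}^N$, an $\mathbf{x}$-parking function (of length $N$) is a sequence $\mathbf{a} \in \mathbb{N}^N$ whose weakly increasing rearrangement $\mathbf{a}^\uparrow$ satisfies $a_i^\uparrow \leq x_1 + x_2 + \cdots + x_i$ for all $i \in [N]$. The set of these is denoted $\operatorname{PF}_N(\mathbf{x})$. *)

theory Defs
  imports Main
begin

text \<open>Sequences are rendered as lists of natural numbers; the \<open>i\<close>-th entry is the
  one at list index \<open>i - 1\<close>. Spots and preferences are numbered from \<open>1\<close>.\<close>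

text \<open>\<open>all_park n S a\<close>: on a street with spots \<open>1, \<dots>, n\<close> of which those in \<open>S\<close> are already occupied,
  cars with preferences \<open>a\<close> enter in order, each taking the first available spot numbered at least
  its preference, and every car finds such a spot.\<close>

fun all_park :: "nat \<Rightarrow> nat set \<Rightarrow> nat list \<Rightarrow> bool" where
  "all_park n S [] = True"
| "all_park n S (p # ps) =
     (let F = {s \<in> {1..n}. p \<le> s \<and> s \<notin> S}
      in F \<noteq> {} \<and> all_park n (insert (Min F) S) ps)"

definition parking_function :: "nat \<Rightarrow> nat list \<Rightarrow> bool" where
  "parking_function n a \<longleftrightarrow> length a = n \<and> set a \<subseteq> {1..n} \<and> all_park n {} a"

definition PC :: "nat \<Rightarrow> nat list \<Rightarrow> nat list set" where
  "PC n t = {c. length c = n - length t \<and> set c \<subseteq> {1..n} \<and> parking_function n (t @ c)}"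

text \<open>Meant for lists \<open>x\<close> of length \<open>N\<close> with positive entries.\<close>

definition PF :: "nat \<Rightarrow> nat list \<Rightarrow> nat list set" where
  "PF N x = {a. length a = N \<and> set a \<subseteq> {1..} \<and>
                (\<forall>i<N. sort a ! i \<le> (\<Sum>j\<le>i. x ! j))}"

text \<open>The first entry followed by the consecutive differences. The subtraction on natural numbers
  does not truncate when \<open>u\<close> is increasing.\<close>

definition gaps :: "nat list \<Rightarrow> nat list" where
  "gaps u = map (\<lambda>i. if i = 0 then u ! 0 else u ! i - u ! (i - 1)) [0..<length u]"

text \<open>The gaps of an increasing list of positive numbers satisfy the proviso on \<open>PF\<close>.\<close>

lemma length_gaps: "length (gaps u) = length u"
  by (simp add: gaps_def)

lemma gaps_pos:
  assumes "sorted_wrt (<) u" and "set u \<subseteq> {1..}"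
  shows "set (gaps u) \<subseteq> {1..}"
proof -
  have "1 \<le> (if i = 0 then u ! 0 else u ! i - u ! (i - 1))" if i: "i < length u" for i
  proof (cases "i = 0")
    case True
    with i have "u ! 0 \<in> set u" by simp
    with assms(2) True show ?thesis by auto
  next
    case False
    with i have "u ! (i - 1) < u ! i"
      by (intro sorted_wrt_nth_less[OF assms(1)]) auto
    with False show ?thesis by simp
  qed
  then show ?thesis
    unfolding gaps_def set_map set_upt image_subset_iff atLeast_iff by (metis atLeastLessThan_iff)
qed

end

theory Submission
  imports Defs
begin

text \<open>Parking succeeds from the occupied set \<open>S\<close> if and only if Hall's condition holds: for every \<open>k\<close>,
  at most as many cars prefer a spot \<open>\<ge> k\<close> as there are free spots \<open>\<ge> k\<close>. If there are
  exactly as many cars as free spots, this says that the sorted preferences are dominated entrywise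
  by the sorted free spots, which are the partial sums of their gaps.\<close>

lemma all_park_iff_Hall:
  "all_park n S c \<longleftrightarrow>
    (\<forall>k. length (filter ((\<le>) k) c) \<le> card {s \<in> {1..n} - S. k \<le> s})"
proof (induction c arbitrary: S)
  case Nil
  show ?case by simp
next
  case (Cons p ps)
  define F where "F = {s \<in> {1..n} - S. p \<le> s}"
  define free where "free S' k = card {s \<in> {1..n} - S'. k \<le> s}" for S' k
  define demand where "demand k = length (filter ((\<le>) k) ps)" for k
  have demand_Cons: "length (filter ((\<le>) k) (p # ps)) = demand k + (if k \<le> p then 1 else 0)" for k
    by (simp add: demand_def)
  have park: "all_park n S (p # ps) \<longleftrightarrow>
      F \<noteq> {} \<and> (\<forall>k. demand k \<le> free (insert (Min F) S) k)"
  proof -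
    have "{s \<in> {1..n}. p \<le> s \<and> s \<notin> S} = F"
      by (auto simp: F_def)
    then show ?thesis
      by (simp only: all_park.simps Let_def Cons.IH free_def demand_def)
  qed
  show ?case
  proof (cases "F = {}")
    case True
    \<comment> \<open>With no spot for the first car, Hall's condition fails at
      \<open>k = p\<close>, where that car itself is counted.\<close>
    then have "free S p = 0"
      by (simp only: free_def F_def card.empty)
    then have "free S p < length (filter ((\<le>) p) (p # ps))"
      by simp
    then show ?thesis
      using park True unfolding free_def by (metis not_le)
  next
    case False
    define s where "s = Min F"
    have "finite F" by (simp add: F_def)
    then have "s \<in> F" and s_min: "\<And>r. r \<in> F \<Longrightarrow> s \<le> r"
      using False by (simp_all add: s_def)
    then have s: "s \<in> {1..n} - S" "p \<le> s"
      by (simp_all add: F_def)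
    have free_step: "free S k = free (insert s S) k + (if k \<le> s then 1 else 0)" for k
    proof (cases "k \<le> s")
      case True
      with s have "{r \<in> {1..n} - S. k \<le> r} = insert s {r \<in> {1..n} - insert s S. k \<le> r}"
        by auto
      then show ?thesis
        using True by (simp add: free_def)
    next
      case False
      then have "{r \<in> {1..n} - S. k \<le> r} = {r \<in> {1..n} - insert s S. k \<le> r}"
        by auto
      then show ?thesis
        using False by (simp add: free_def)
    qed
    \<comment> \<open>Removing the first car lowers the demand for \<open>k \<le> p\<close>, while
      occupying \<open>s\<close> lowers the supply for \<open>k \<le> s\<close>. As
      \<open>p \<le> s\<close>, the two conditions can differ only for \<open>p < k \<le> s\<close>,
      where the left one is stronger by 1.\<close>
    have "(\<forall>k. demand k \<le> free (insert s S) k) \<longleftrightarrow>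
        (\<forall>k. demand k + (if k \<le> p then 1 else 0) \<le> free S k)" (is "?L \<longleftrightarrow> ?R")
    proof
      assume ?L
      then show ?R
        using s(2) by (auto simp: free_step intro: le_SucI)
    next
      assume R: ?R
      show ?L
      proof
        fix k
        show "demand k \<le> free (insert s S) k"
        proof (cases "p < k \<and> k \<le> s")
          case True
          \<comment> \<open>No spot in \<open>{p..<s}\<close> is free, so the condition at \<open>k\<close> is inherited from \<open>p\<close>.\<close>
          have "demand k \<le> demand p"
            using True by (auto simp: demand_def length_filter_conv_card intro!: card_mono)
          \<comment> \<open>At \<open>p\<close> the first car and the spot \<open>s\<close> each
            contribute 1, and these cancel.\<close>
          also have "\<dots> \<le> free (insert s S) p"
            using R[rule_format, of p] s(2) by (simp add: free_step)
          also have "\<dots> = free (insert s S) k"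
          proof -
            have "k \<le> r" if "r \<in> {1..n} - S" "p \<le> r" for r
              using s_min[of r] that True by (simp add: F_def)
            with True have "{r \<in> {1..n} - insert s S. p \<le> r} = {r \<in> {1..n} - insert s S. k \<le> r}"
              by auto
            then show ?thesis by (simp only: free_def)
          qed
          finally show ?thesis .
        next
          case False
          then show ?thesis
            using R[rule_format, of k] s(2) by (auto simp: free_step split: if_splits)
        qed
      qed
    qed
    then show ?thesis
      using park False by (simp only: demand_Cons s_def free_def) simp
  qed
qed

text \<open>Domination carries each index counted for \<open>xs\<close> over to \<open>ys\<close>.
  Conversely, take the threshold \<open>k = xs ! i\<close>: all entries of \<open>xs\<close> from
  index \<open>i\<close> on reach it, but if \<open>ys ! i\<close> were smaller, only entries of
  \<open>ys\<close> after index \<open>i\<close> could, which is at least one fewer.\<close>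

lemma sorted_nth_le_iff_filter:
  fixes xs ys :: "'a :: linorder list"
  assumes "sorted xs" "sorted ys" and len: "length xs = length ys"
  shows "(\<forall>i < length xs. xs ! i \<le> ys ! i) \<longleftrightarrow>
    (\<forall>k. length (filter ((\<le>) k) xs) \<le> length (filter ((\<le>) k) ys))"
proof (intro iffI allI impI)
  fix k
  assume "\<forall>i < length xs. xs ! i \<le> ys ! i"
  then show "length (filter ((\<le>) k) xs) \<le> length (filter ((\<le>) k) ys)"
    unfolding length_filter_conv_card len by (intro card_mono) (auto intro: order_trans)
next
  fix i
  assume count: "\<forall>k. length (filter ((\<le>) k) xs) \<le> length (filter ((\<le>) k) ys)"
    and i: "i < length xs"
  show "xs ! i \<le> ys ! i"
  proof (rule ccontr)
    assume less: "\<not> xs ! i \<le> ys ! i"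
    have "{i..<length xs} \<subseteq> {j. j < length xs \<and> xs ! i \<le> xs ! j}"
      using assms(1) by (auto intro: sorted_nth_mono)
    then have "card {i..<length xs} \<le> length (filter ((\<le>) (xs ! i)) xs)"
      unfolding length_filter_conv_card by (intro card_mono) auto
    also have "\<dots> \<le> length (filter ((\<le>) (xs ! i)) ys)"
      using count by blast
    also have "\<dots> \<le> card {Suc i..<length xs}"
    proof -
      have "i < j" if "j < length ys" "xs ! i \<le> ys ! j" for j
      proof (rule ccontr)
        assume "\<not> i < j"
        then have "ys ! j \<le> ys ! i"
          using assms(2) i len by (intro sorted_nth_mono) auto
        with that less show False by (meson order_trans)
      qed
      then show ?thesis
        unfolding length_filter_conv_card by (intro card_mono) (auto simp: len Suc_le_eq)
    qed
    finally show False using i by simp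
  qed
qed

lemma sum_gaps:
  assumes "sorted u" "i < length u"
  shows "(\<Sum>j\<le>i. gaps u ! j) = u ! i"
  using assms(2)
proof (induction i)
  case 0
  then show ?case by (simp add: gaps_def)
next
  case (Suc i)
  \<comment> \<open>This keeps the subtraction in \<open>gaps\<close> from truncating, so that the
    sum telescopes.\<close>
  then have "u ! i \<le> u ! Suc i"
    using assms(1) by (intro sorted_nth_mono) auto
  with Suc show ?case by (simp add: gaps_def)
qed

text \<open>Each car of \<open>t\<close> finds its preferred spot free and takes it, because the
  entries are distinct and avoid \<open>S\<close>. \<open>S\<close> varies in the induction, since
  it absorbs the spots already taken.\<close>

lemma all_park_append_increasing:
  assumes "sorted_wrt (<) t" "set t \<subseteq> {1..n}" "set t \<inter> S = {}"
  shows "all_park n S (t @ c) \<longleftrightarrow> all_park n (S \<union> set t) c"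
  using assms
proof (induction t arbitrary: S)
  case Nil
  then show ?case by simp
next
  case (Cons p t)
  have "Min {s \<in> {1..n}. p \<le> s \<and> s \<notin> S} = p"
    using Cons.prems by (intro Min_eqI) auto
  moreover have "{s \<in> {1..n}. p \<le> s \<and> s \<notin> S} \<noteq> {}"
    using Cons.prems by auto
  moreover have "all_park n (insert p S) (t @ c) \<longleftrightarrow> all_park n (insert p S \<union> set t) c"
    using Cons.prems by (intro Cons.IH) auto
  ultimately show ?case by (simp add: Let_def)
qed

theorem theorem2p7:
  fixes n m :: nat and t u x :: "nat list"
  assumes "n \<ge> 1" and "m \<le> n"
    and "length t = m" and "set t \<subseteq> {1..n}" and "sorted_wrt (<) t"
    and "u = sorted_list_of_set ({1..n} - set t)"
    and "x = gaps u"
  shows "PC n t = PF (n - m) x"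
proof -
  define U where "U = {1..n} - set t"
  have u: "sorted u" "distinct u" "set u = U"
    using assms(6) by (simp_all add: U_def)
  have "distinct t"
    using assms(5) by (simp add: strict_sorted_iff)
  \<comment> \<open>There are as many free spots as remaining cars, so \<open>sort c\<close> and
    \<open>u\<close> can be compared entry by entry.\<close>
  then have "length u = n - m"
    using u assms(3,4) distinct_card[of u] distinct_card[of t] by (simp add: U_def card_Diff_subset)
  have dominated: "all_park n {} (t @ c) \<longleftrightarrow> (\<forall>i < n - m. sort c ! i \<le> u ! i)"
    if c: "length c = n - m" for c
  proof -
    have "card {s \<in> U. k \<le> s} = length (filter ((\<le>) k) u)" for k
      using u distinct_card[of "filter ((\<le>) k) u"] by simp
    moreover have "length (filter ((\<le>) k) c) = length (filter ((\<le>) k) (sort c))" for k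
      by (simp add: filter_sort)
    ultimately have "all_park n (set t) c \<longleftrightarrow>
        (\<forall>k. length (filter ((\<le>) k) (sort c)) \<le> length (filter ((\<le>) k) u))"
      by (simp only: all_park_iff_Hall U_def)
    also have "\<dots> \<longleftrightarrow> (\<forall>i < n - m. sort c ! i \<le> u ! i)"
      using sorted_nth_le_iff_filter[of "sort c" u] u(1) c \<open>length u = n - m\<close> by simp
    finally show ?thesis
      using all_park_append_increasing[of t n "{}" c] assms(4,5) by simp
  qed
  \<comment> \<open>\<open>PC\<close> bounds preferences by \<open>n\<close>, while
    \<open>PF\<close> states no such bound. It follows from domination, as every entry of
    \<open>c\<close> lies below some free spot.\<close>
  have bounded: "set c \<subseteq> {..n}"
    if c: "length c = n - m" and le: "\<forall>i < n - m. sort c ! i \<le> u ! i" for c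
  proof
    fix y
    assume "y \<in> set c"
    then have "y \<in> set (sort c)" by simp
    then obtain i where i: "i < n - m" "y = sort c ! i"
      using c by (metis in_set_conv_nth length_sort)
    have "u ! i \<in> U"
      using nth_mem[of i u] i \<open>length u = n - m\<close> by (simp only: u(3))
    moreover have "y \<le> u ! i"
      using i le by simp
    ultimately show "y \<in> {..n}"
      by (simp add: U_def)
  qed
  have "(\<Sum>j\<le>i. x ! j) = u ! i" if "i < n - m" for i
    using sum_gaps u(1) \<open>length u = n - m\<close> assms(7) that by simp
  then have PF: "PF (n - m) x =
      {c. length c = n - m \<and> set c \<subseteq> {1..} \<and> (\<forall>i < n - m. sort c ! i \<le> u ! i)}"
    unfolding PF_def by auto
  have "PC n t = {c. length c = n - m \<and> set c \<subseteq> {1..n} \<and> all_park n {} (t @ c)}"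
    using assms(2-4) by (auto simp: PC_def parking_function_def)
  also have "\<dots> = PF (n - m) x"
  proof -
    have "set c \<subseteq> {1..n} \<longleftrightarrow> set c \<subseteq> {1..} \<and> set c \<subseteq> {..n}" for c :: "nat list"
      by auto
    then show ?thesis
      unfolding PF using dominated bounded by blast
  qed
  finally show ?thesis .
qed

end
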